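(* Let $G$ be a connected graph of order $n$, minimum degree $\delta$ and vertex-connectivity $\kappa$, and let $k$ be an integer with $\delta\geq k\geq 2$. Let $H=K_{k-1}\vee (K_{\delta-k+2}\cup K_{n-\delta-1})$; its spectral radius $\rho(H)$ is the largest root of $$\lambda^3 - (n - 3)\lambda^2 + ((\delta-k+2)(n-\delta-1)-2n+3)\lambda +(\delta-k+2)(n-\delta-1)k - n+1=0.$$ If $\rho(G)\geq \rho(H)$, then $\kappa\geq k$, unless $G\cong H$.
   Context: All graphs are finite, simple and undirected. $\rho(G)$ denotes the spectral radius (largest eigenvalue) of the adjacency matrix of $G$. The vertex-connectivity $\kappa(G)$ of a connected non-complete graph is the minimum size of a vertex set whose removal disconnects $G$, and $\kappa(K_n)=n-1$. $K_r$ is the complete graph on $r$ vertices, $\cup$ is disjoint union and $G_1\vee G_2$ is the join (disjoint union plus all edges between $G_1$ and $G_2$). *)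

theory Defs
  imports
    "Jordan_Normal_Form.Char_Poly"
    "Graph_Theory.Graph_Theory"
begin

text \<open>
  Finite simple undirected graphs are the \<^locale>\<open>pair_graph\<close>s of Graph_Theory: finite vertex set,
  irreflexive symmetric arc relation. An undirected edge is a pair of opposite arcs, so degrees are
  out-degrees, and \<^const>\<open>digraph_iso\<close> on such graphs is graph isomorphism.
\<close>

definition min_degree :: "'a pair_pre_digraph \<Rightarrow> nat" where
  "min_degree G = Min (out_degree (with_proj G) ` pverts G)"

text \<open>
  The deleted set is required to be a proper subset because Graph_Theory counts the graph without
  vertices as not connected. The value is meant for connected graphs.
\<close>

definition vertex_connectivity :: "'a pair_pre_digraph \<Rightarrow> nat" where
  "vertex_connectivity G =
     (if complete_digraph (card (pverts G)) (with_proj G) then card (pverts G) - 1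
      else Min {card S |S. S \<subset> pverts G \<and>
                  \<not> Digraph_Component.connected (with_proj G \<restriction> (pverts G - S))})"

text \<open>
  Matrices are indexed by numbers, so the adjacency matrix needs an enumeration of the vertices.
  The choice has no influence on the eigenvalues, see \<open>eigenvalue_adjacency_matrix_iff\<close> below.
\<close>

definition vertex_list :: "'a pair_pre_digraph \<Rightarrow> 'a list" where
  "vertex_list G = (SOME vs. distinct vs \<and> set vs = pverts G)"

definition adjacency_matrix :: "'a pair_pre_digraph \<Rightarrow> real mat" where
  "adjacency_matrix G = mat (card (pverts G)) (card (pverts G))
     (\<lambda>(i, j). if (vertex_list G ! i, vertex_list G ! j) \<in> parcs G then 1 else 0)"

text \<open>
  The matrix is real symmetric, so its largest real eigenvalue is its largest eigenvalue.
\<close>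

definition graph_spectral_radius :: "'a pair_pre_digraph \<Rightarrow> real" where
  "graph_spectral_radius G = Max {l. eigenvalue (adjacency_matrix G) l}"

definition complete_graph :: "nat \<Rightarrow> nat pair_pre_digraph" where
  "complete_graph r = \<lparr> pverts = {..<r}, parcs = {(u, v). u < r \<and> v < r \<and> u \<noteq> v} \<rparr>"

definition disjoint_union ::
    "'a pair_pre_digraph \<Rightarrow> 'b pair_pre_digraph \<Rightarrow> ('a + 'b) pair_pre_digraph" where
  "disjoint_union G H =
     \<lparr> pverts = pverts G <+> pverts H,
       parcs = map_prod Inl Inl ` parcs G \<union> map_prod Inr Inr ` parcs H \<rparr>"

definition graph_join ::
    "'a pair_pre_digraph \<Rightarrow> 'b pair_pre_digraph \<Rightarrow> ('a + 'b) pair_pre_digraph" where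
  "graph_join G H =
     \<lparr> pverts = pverts (disjoint_union G H),
       parcs = parcs (disjoint_union G H)
         \<union> (Inl ` pverts G) \<times> (Inr ` pverts H) \<union> (Inr ` pverts H) \<times> (Inl ` pverts G) \<rparr>"

lemma vertex_list:
  assumes "finite (pverts G)"
  shows "distinct (vertex_list G)" "set (vertex_list G) = pverts G"
    "length (vertex_list G) = card (pverts G)"
proof -
  have "\<exists>vs. distinct vs \<and> set vs = pverts G"
    using finite_distinct_list[OF assms] by blast
  from someI_ex[OF this]
  show *: "distinct (vertex_list G)" "set (vertex_list G) = pverts G"
    by (simp_all add: vertex_list_def)
  show "length (vertex_list G) = card (pverts G)"
    using distinct_card[OF *(1)] *(2) by simp
qed

lemma eigenvalue_adjacency_matrix_iff:
  assumes "finite (pverts G)"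
  shows "eigenvalue (adjacency_matrix G) l \<longleftrightarrow>
    (\<exists>x. (\<exists>u \<in> pverts G. x u \<noteq> 0) \<and>
      (\<forall>u \<in> pverts G. (\<Sum>v \<in> {v \<in> pverts G. (u, v) \<in> parcs G}. x v) = l * x u))"
proof -
  define n where "n = card (pverts G)"
  define vs where "vs = vertex_list G"
  note vl = vertex_list[OF assms, folded vs_def n_def]
  have bij: "bij_betw ((!) vs) {..<n} (pverts G)"
    by (rule bij_betw_nth) (simp_all add: vl)
  have nbr: "(\<Sum>v \<in> {v \<in> pverts G. (vs ! i, v) \<in> parcs G}. x v) =
      (\<Sum>j<n. (if (vs ! i, vs ! j) \<in> parcs G then 1 else 0) * x (vs ! j))" for i and x :: "'a \<Rightarrow> real"
  proof -
    have "(\<Sum>v \<in> {v \<in> pverts G. (vs ! i, v) \<in> parcs G}. x v) =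
        (\<Sum>v \<in> pverts G. (if (vs ! i, v) \<in> parcs G then 1 else 0) * x v)"
      using assms by (intro sum.mono_neutral_cong_left) auto
    then show ?thesis
      using sum.reindex_bij_betw[OF bij, of "\<lambda>v. (if (vs ! i, v) \<in> parcs G then 1 else 0) * x v"]
      by simp
  qed
  have Av: "(adjacency_matrix G *\<^sub>v v) $ i =
      (\<Sum>j<n. (if (vs ! i, vs ! j) \<in> parcs G then 1 else 0) * v $ j)"
    if "i < n" "v \<in> carrier_vec n" for v i
    using that by (auto simp: adjacency_matrix_def vs_def n_def scalar_prod_def lessThan_atLeast0
        intro!: sum.cong)
  have vtx: "\<exists>i<n. u = vs ! i" if "u \<in> pverts G" for u
    using that bij_betw_imp_surj_on[OF bij] by blast
  have dim: "dim_row (adjacency_matrix G) = n"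
    by (simp add: adjacency_matrix_def n_def)
  show ?thesis
  proof
    assume "eigenvalue (adjacency_matrix G) l"
    then obtain v where v: "v \<in> carrier_vec n" "v \<noteq> 0\<^sub>v n"
      and ev: "adjacency_matrix G *\<^sub>v v = l \<cdot>\<^sub>v v"
      by (auto simp: eigenvalue_def eigenvector_def dim)
    define x where "x u = v $ (the_inv_into {..<n} ((!) vs) u)" for u
    have x: "x (vs ! i) = v $ i" if "i < n" for i
      using the_inv_into_f_f[of "(!) vs" "{..<n}" i] bij that
      by (simp add: x_def bij_betw_def)
    obtain i where i: "i < n" "v $ i \<noteq> 0"
      using v by (auto simp: vec_eq_iff)
    have "(\<Sum>v \<in> {v \<in> pverts G. (u, v) \<in> parcs G}. x v) = l * x u" if "u \<in> pverts G" for u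
    proof -
      obtain i where i: "i < n" "u = vs ! i"
        using vtx[OF \<open>u \<in> pverts G\<close>] by blast
      have "(adjacency_matrix G *\<^sub>v v) $ i = l * v $ i"
        using ev i v by simp
      then show ?thesis
        using x[OF i(1)] by (simp add: i(2) nbr Av[OF i(1) v(1)] x)
    qed
    moreover have "x (vs ! i) \<noteq> 0" "vs ! i \<in> pverts G"
      using i x bij by (auto simp: bij_betw_def)
    ultimately show "\<exists>x. (\<exists>u \<in> pverts G. x u \<noteq> 0) \<and>
      (\<forall>u \<in> pverts G. (\<Sum>v \<in> {v \<in> pverts G. (u, v) \<in> parcs G}. x v) = l * x u)"
      by blast
  next
    assume "\<exists>x. (\<exists>u \<in> pverts G. x u \<noteq> 0) \<and>
      (\<forall>u \<in> pverts G. (\<Sum>v \<in> {v \<in> pverts G. (u, v) \<in> parcs G}. x v) = l * x u)"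
    then obtain x u where u: "u \<in> pverts G" "x u \<noteq> 0"
      and eq: "\<And>u. u \<in> pverts G \<Longrightarrow> (\<Sum>v \<in> {v \<in> pverts G. (u, v) \<in> parcs G}. x v) = l * x u"
      by blast
    define v where "v = vec n (\<lambda>i. x (vs ! i))"
    have v: "v \<in> carrier_vec n" by (simp add: v_def)
    obtain i where "i < n" "u = vs ! i"
      using vtx[OF u(1)] by blast
    then have "v \<noteq> 0\<^sub>v n"
      using u by (auto simp: v_def vec_eq_iff)
    moreover have "adjacency_matrix G *\<^sub>v v = l \<cdot>\<^sub>v v"
    proof (rule eq_vecI)
      fix i assume "i < dim_vec (l \<cdot>\<^sub>v v)"
      then have i: "i < n" by (simp add: v_def)
      then have "vs ! i \<in> pverts G"
        using bij by (auto simp: bij_betw_def)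
      from eq[OF this] show "(adjacency_matrix G *\<^sub>v v) $ i = (l \<cdot>\<^sub>v v) $ i"
        unfolding Av[OF i v] nbr using i by (simp add: v_def)
    qed (simp add: dim v_def)
    ultimately show "eigenvalue (adjacency_matrix G) l"
      using v by (auto simp: eigenvalue_def eigenvector_def dim)
  qed
qed

end

theory Submission
  imports Defs "Jordan_Normal_Form.Spectral_Radius"
begin

text \<open>
  If \<open>\<kappa> < k\<close>, then \<open>G\<close> is a spanning subgraph of \<open>K\<^sub>s \<or> (K\<^bsub>a'\<^esub> \<union> K\<^bsub>b'\<^esub>)\<close> with
  \<open>s = k - 1\<close>, where \<open>a', b' \<ge> a = \<delta> - k + 2\<close> by the degree condition. Put \<open>b = n - \<delta> - 1\<close>. The quotient matrix
  of such a join gives the cubic \<open>y^3 - n y^2 + a' b' (y + s)\<close> in \<open>y = \<lambda> + 1\<close>, and \<open>a' b' \<ge> a b\<close>. Hence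
  for \<open>y = \<rho>(H) + 1\<close> the vector with entries \<open>(y - a')(y - b')\<close>, \<open>s (y - b')\<close>, \<open>s (y - a')\<close> on the
  three parts is a positive supersolution \<open>A z \<le> \<rho>(H) z\<close> for the adjacency matrix \<open>A\<close> of \<open>G\<close>. Pairing
  \<open>z\<close> with the absolute values of an eigenvector gives \<open>\<rho>(G) \<le> \<rho>(H)\<close>; as \<open>G\<close> is connected, equality
  forces \<open>A z = \<rho>(H) z\<close>, so no edge of the join is missing and \<open>a' b' = a b\<close>.
\<close>

section \<open>Largest eigenvalue of an adjacency matrix\<close>

text \<open>Over the complex numbers the spectrum is non-empty. Symmetry makes the eigenvalue found
  there real, and then the real or the imaginary part of its eigenvector is a real eigenvector. This
  makes the \<open>Max\<close> in \<open>graph_spectral_radius\<close> range over a non-empty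
  set.\<close>

lemma real_symmetric_eigenvalue_exists:
  fixes A :: "real mat"
  assumes A: "A \<in> carrier_mat n n" and n: "n > 0"
    and sym: "\<And>i j. i < n \<Longrightarrow> j < n \<Longrightarrow> A $$ (i, j) = A $$ (j, i)"
  shows "\<exists>l. eigenvalue A l"
proof -
  define B where "B = map_mat complex_of_real A"
  have B: "B \<in> carrier_mat n n" using A by (simp add: B_def)
  obtain c where "eigenvalue B c"
    using spectrum_non_empty[OF B] n by (auto simp: spectrum_def)
  then obtain v where v: "v \<in> carrier_vec n" "v \<noteq> 0\<^sub>v n" and ev: "B *\<^sub>v v = c \<cdot>\<^sub>v v"
    using B by (auto simp: eigenvalue_def eigenvector_def)
  define a b where "a i = Re (v $ i)" and "b i = Im (v $ i)" for i
  have eq: "(\<Sum>j<n. complex_of_real (A $$ (i, j)) * v $ j) = c * v $ i" if "i < n" for i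
  proof -
    have "(B *\<^sub>v v) $ i = (\<Sum>j<n. complex_of_real (A $$ (i, j)) * v $ j)"
      using A v that by (auto simp: B_def scalar_prod_def lessThan_atLeast0 intro!: sum.cong)
    then show ?thesis using ev v that by simp
  qed
  have re: "(\<Sum>j<n. A $$ (i, j) * a j) = Re c * a i - Im c * b i" if "i < n" for i
    using arg_cong[OF eq[OF that], of Re] by (simp add: a_def b_def)
  have im: "(\<Sum>j<n. A $$ (i, j) * b j) = Re c * b i + Im c * a i" if "i < n" for i
    using arg_cong[OF eq[OF that], of Im] by (simp add: a_def b_def)
  \<comment> \<open>By symmetry, pairing \<open>b\<close> with \<open>A a\<close> equals pairing
    \<open>a\<close> with \<open>A b\<close>; inserting \<open>re\<close> and \<open>im\<close>
    leaves \<open>Im c\<close> times the squared norm of the eigenvector.\<close>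
  have "(\<Sum>i<n. b i * (\<Sum>j<n. A $$ (i, j) * a j)) = (\<Sum>i<n. \<Sum>j<n. A $$ (i, j) * a j * b i)"
    by (simp add: sum_distrib_left mult_ac)
  also have "\<dots> = (\<Sum>j<n. \<Sum>i<n. A $$ (i, j) * a j * b i)"
    by (rule sum.swap)
  also have "\<dots> = (\<Sum>i<n. a i * (\<Sum>j<n. A $$ (i, j) * b j))"
    by (auto simp: sum_distrib_left mult_ac sym intro!: sum.cong)
  finally have "(\<Sum>i<n. b i * (Re c * a i - Im c * b i)) = (\<Sum>i<n. a i * (Re c * b i + Im c * a i))"
    by (simp add: re im)
  then have "Im c * (\<Sum>i<n. (a i)\<^sup>2 + (b i)\<^sup>2) = 0"
    by (simp add: algebra_simps sum.distrib sum_subtractf sum_distrib_left power2_eq_square)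
  moreover obtain i where i: "i < n" "a i \<noteq> 0 \<or> b i \<noteq> 0"
    using v by (auto simp: vec_eq_iff a_def b_def complex_eq_iff)
  then have "(\<Sum>i<n. (a i)\<^sup>2 + (b i)\<^sup>2) > 0"
    by (intro sum_pos2[of _ i]) (auto simp: sum_power2_gt_zero_iff)
  ultimately have "Im c = 0" by simp
  obtain x where x: "\<And>i. i < n \<Longrightarrow> (\<Sum>j<n. A $$ (i, j) * x j) = Re c * x i" "x i \<noteq> 0"
    using i(2) re im \<open>Im c = 0\<close> by (elim disjE) auto
  have "vec n x \<noteq> 0\<^sub>v n"
    using x(2) i(1) by (auto simp: vec_eq_iff)
  moreover have "A *\<^sub>v vec n x = Re c \<cdot>\<^sub>v vec n x"
    using A x(1) by (auto simp: scalar_prod_def lessThan_atLeast0 intro!: eq_vecI)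
  ultimately have "eigenvector A (vec n x) (Re c)"
    using A by (auto simp: eigenvector_def)
  then show ?thesis by (auto simp: eigenvalue_def)
qed

lemma finite_eigenvalues:
  fixes A :: "'a :: field mat"
  assumes "A \<in> carrier_mat n n"
  shows "finite {l. eigenvalue A l}"
  using card_finite_spectrum(1)[OF assms] by (simp add: spectrum_def)

lemma adjacency_matrix_carrier:
  "adjacency_matrix G \<in> carrier_mat (card (pverts G)) (card (pverts G))"
  by (simp add: adjacency_matrix_def)

lemma eigenvalue_le_graph_spectral_radius:
  assumes "eigenvalue (adjacency_matrix G) l"
  shows "l \<le> graph_spectral_radius G"
  unfolding graph_spectral_radius_def
  using finite_eigenvalues[OF adjacency_matrix_carrier] assms by (intro Max_ge) auto

lemma eigenvalue_graph_spectral_radius: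
  assumes "finite (pverts G)" "pverts G \<noteq> {}" "sym (parcs G)"
  shows "eigenvalue (adjacency_matrix G) (graph_spectral_radius G)"
proof -
  have "\<exists>l. eigenvalue (adjacency_matrix G) l"
    using assms by (intro real_symmetric_eigenvalue_exists[OF adjacency_matrix_carrier])
      (auto simp: adjacency_matrix_def card_gt_0_iff dest: symD)
  then show ?thesis
    using Max_in[OF finite_eigenvalues[OF adjacency_matrix_carrier[of G]]]
    by (auto simp: graph_spectral_radius_def)
qed

section \<open>Connectivity in terms of cuts\<close>

text \<open>A walk cannot leave a set without crossing arcs, and the set reachable from a vertex is
  such a set. This form serves both to split a disconnected induced subgraph and to show that the
  support of an eigenvector is the whole vertex set.\<close>

lemma connected_iff_no_cut:
  "Digraph_Component.connected K \<longleftrightarrow> verts K \<noteq> {} \<and>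
    (\<forall>A \<subseteq> verts K. A \<noteq> {} \<longrightarrow>
      (\<forall>u \<in> A. \<forall>v \<in> verts K - A. (u, v) \<notin> arcs_ends K \<and> (v, u) \<notin> arcs_ends K) \<longrightarrow> A = verts K)"
    (is "_ \<longleftrightarrow> ?R")
proof -
  let ?E = "parcs (mk_symmetric K)"
  have E: "(u, v) \<in> ?E \<longleftrightarrow> (u, v) \<in> arcs_ends K \<or> (v, u) \<in> arcs_ends K" for u v
    by (auto simp: mk_symmetric_def arcs_ends_conv)
  have con: "Digraph_Component.connected K \<longleftrightarrow>
      verts K \<noteq> {} \<and> (\<forall>u \<in> verts K. \<forall>v \<in> verts K. (u, v) \<in> rtrancl_on (verts K) ?E)"
    by (simp add: connected_def strongly_connected_def reachable_def mk_symmetric_def)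
  show ?thesis
  proof
    assume L: "Digraph_Component.connected K"
    have "w \<in> A" if A: "A \<subseteq> verts K" "u \<in> A"
        "\<forall>u \<in> A. \<forall>v \<in> verts K - A. (u, v) \<notin> arcs_ends K \<and> (v, u) \<notin> arcs_ends K"
        and w: "w \<in> verts K" for A u w
    proof -
      have "(u, w) \<in> rtrancl_on (verts K) ?E" using L A w by (auto simp: con)
      then show ?thesis
        by (induction rule: rtrancl_on_induct) (use A E in auto)
    qed
    then show ?R using L con by (metis ex_in_conv subsetI subset_antisym)
  next
    assume R: ?R
    have "(u, v) \<in> rtrancl_on (verts K) ?E" if uv: "u \<in> verts K" "v \<in> verts K" for u v
    proof -
      define A where "A = {w \<in> verts K. (u, w) \<in> rtrancl_on (verts K) ?E}"
      have "u \<in> A" "A \<subseteq> verts K" using uv by (auto simp: A_def)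
      moreover have "\<forall>x \<in> A. \<forall>y \<in> verts K - A. (x, y) \<notin> arcs_ends K \<and> (y, x) \<notin> arcs_ends K"
        using E by (auto simp: A_def intro: rtrancl_on_into_rtrancl_on)
      ultimately have "A = verts K"
        using R[THEN conjunct2, THEN spec, of A] by auto
      then show ?thesis using uv unfolding A_def by blast
    qed
    then show "Digraph_Component.connected K" using R by (simp add: con)
  qed
qed

section \<open>Bounding eigenvalues by a positive supersolution\<close>

lemma eigenvalue_test_vector:
  fixes z :: "'a \<Rightarrow> real"
  assumes fin: "finite (pverts G)" and sym: "sym (parcs G)"
    and pos: "\<And>u. u \<in> pverts G \<Longrightarrow> z u > 0"
    and super: "\<And>u. u \<in> pverts G \<Longrightarrow> (\<Sum>v \<in> {v \<in> pverts G. (u, v) \<in> parcs G}. z v) \<le> r * z u"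
    and ev: "eigenvalue (adjacency_matrix G) l"
  shows eigenvalue_le_of_test_vector: "l \<le> r"
    and eigenvalue_eq_of_test_vector:
      "\<lbrakk>Digraph_Component.connected (with_proj G); r \<le> l; u \<in> pverts G\<rbrakk>
        \<Longrightarrow> (\<Sum>v \<in> {v \<in> pverts G. (u, v) \<in> parcs G}. z v) = r * z u"
proof -
  let ?V = "pverts G"
  let ?N = "\<lambda>u. {v \<in> ?V. (u, v) \<in> parcs G}"
  obtain x u0 where u0: "u0 \<in> ?V" "x u0 \<noteq> 0"
    and x: "\<And>u. u \<in> ?V \<Longrightarrow> (\<Sum>v \<in> ?N u. x v) = l * x u"
    using ev unfolding eigenvalue_adjacency_matrix_iff[OF fin] by blast
  define w where "w u = \<bar>x u\<bar>" for u
  \<comment> \<open>\<open>D\<close> is the defect of \<open>z\<close> as a supersolution for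
    \<open>r\<close>, \<open>E\<close> that of \<open>w\<close> as a subsolution for
    \<open>l\<close>. Both are non-negative, \<open>E\<close> by the triangle inequality.\<close>
  define D where "D u = r * z u - (\<Sum>v \<in> ?N u. z v)" for u
  define E where "E u = (\<Sum>v \<in> ?N u. w v) - l * w u" for u
  have E: "E u \<ge> 0" if "u \<in> ?V" for u
  proof -
    have "l * w u \<le> \<bar>l * x u\<bar>" by (simp add: w_def abs_mult mult_right_mono)
    also have "\<dots> \<le> (\<Sum>v \<in> ?N u. w v)"
      unfolding x[OF that, symmetric] w_def by (rule sum_abs)
    finally show ?thesis by (simp add: E_def)
  qed
  have D: "D u \<ge> 0" if "u \<in> ?V" for u using super[OF that] by (simp add: D_def)
  have indic: "(\<Sum>v \<in> ?N u. f v) = (\<Sum>v \<in> ?V. if (u, v) \<in> parcs G then f v else 0)"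
    for u and f :: "'a \<Rightarrow> real"
    using fin by (simp add: sum.inter_filter)
  have "(\<Sum>u \<in> ?V. z u * (\<Sum>v \<in> ?N u. w v)) =
      (\<Sum>u \<in> ?V. \<Sum>v \<in> ?V. if (u, v) \<in> parcs G then z u * w v else 0)"
    unfolding indic sum_distrib_left by (intro sum.cong) auto
  also have "\<dots> = (\<Sum>v \<in> ?V. \<Sum>u \<in> ?V. if (u, v) \<in> parcs G then z u * w v else 0)"
    by (rule sum.swap)
  also have "\<dots> = (\<Sum>u \<in> ?V. w u * (\<Sum>v \<in> ?N u. z v))"
    unfolding indic sum_distrib_left using sym by (intro sum.cong) (auto dest: symD)
  \<comment> \<open>The adjacency sums cancel because the matrix is symmetric. The left side is
    non-negative and the last factor positive, hence \<open>l \<le> r\<close>.\<close>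
  finally have "(\<Sum>u \<in> ?V. z u * E u) + (\<Sum>u \<in> ?V. w u * D u) = (r - l) * (\<Sum>u \<in> ?V. z u * w u)"
    by (simp add: D_def E_def algebra_simps sum.distrib sum_subtractf sum_distrib_left)
  moreover have zE: "(\<Sum>u \<in> ?V. z u * E u) \<ge> 0"
    using E pos by (intro sum_nonneg) (simp add: less_imp_le)
  moreover have wD: "(\<Sum>u \<in> ?V. w u * D u) \<ge> 0"
    using D by (intro sum_nonneg) (simp add: w_def)
  moreover have zw: "(\<Sum>u \<in> ?V. z u * w u) > 0"
    using fin u0 pos by (intro sum_pos2[of _ u0]) (auto simp: w_def less_imp_le)
  ultimately show le: "l \<le> r"
    by (smt (verit) mult_neg_pos)
  assume con: "Digraph_Component.connected (with_proj G)" and "r \<le> l" and u: "u \<in> ?V"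
  with le have "r = l" by simp
  then have "(\<Sum>u \<in> ?V. z u * E u) = 0" "(\<Sum>u \<in> ?V. w u * D u) = 0"
    using \<open>_ = (r - l) * _\<close> zE wD by simp_all
  then have "\<forall>u \<in> ?V. z u * E u = 0" and wD0: "\<forall>u \<in> ?V. w u * D u = 0"
    using sum_nonneg_eq_0_iff[OF fin, of "\<lambda>u. z u * E u"] E pos
      sum_nonneg_eq_0_iff[OF fin, of "\<lambda>u. w u * D u"] D
    by (simp_all add: w_def less_imp_le)
  then have E0: "E u = 0" if "u \<in> ?V" for u
    using pos that by fastforce
  \<comment> \<open>In the equality case both defects vanish when weighted, but \<open>w\<close> may
    have zeros. Since \<open>E = 0\<close>, a zero of \<open>w\<close> spreads to all neighbours, so
    by connectedness the support \<open>P\<close> is everything and \<open>D\<close> itself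
    vanishes.\<close>
  define P where "P = {u \<in> ?V. w u \<noteq> 0}"
  have closed: "w v = 0" if "u \<in> ?V" "w u = 0" "v \<in> ?N u" for u v
  proof -
    have "(\<Sum>v \<in> ?N u. w v) = 0" using E0[OF that(1)] that(2) by (simp add: E_def)
    then show ?thesis
      using fin that(3) by (subst (asm) sum_nonneg_eq_0_iff) (auto simp: w_def)
  qed
  then have "\<forall>u \<in> P. \<forall>v \<in> ?V - P. (u, v) \<notin> parcs G \<and> (v, u) \<notin> parcs G"
    using sym by (auto simp: P_def dest: symD)
  moreover have "P \<noteq> {}" using u0 by (auto simp: P_def w_def)
  moreover have "P \<subseteq> ?V" by (auto simp: P_def)
  ultimately have "P = ?V" using con by (auto simp: connected_iff_no_cut)
  then have "w u \<noteq> 0" using u by (auto simp: P_def)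
  then show "(\<Sum>v \<in> ?N u. z v) = r * z u"
    using wD0 u by (auto simp: D_def)
qed

section \<open>The cubic of the quotient matrix\<close>

text \<open>Characteristic polynomial of the matrix with rows \<open>(s, a, b)\<close>,
  \<open>(s, a, 0)\<close>, \<open>(s, 0, b)\<close>, the quotient matrix plus the identity. For
  fixed \<open>s\<close> and \<open>a + b\<close> it depends only on \<open>a * b\<close>.\<close>

definition join_cubic :: "real \<Rightarrow> real \<Rightarrow> real \<Rightarrow> real \<Rightarrow> real" where
  "join_cubic s a b y = y ^ 3 - (s + a + b) * y\<^sup>2 + a * b * (y + s)"

text \<open>The intermediate value theorem applies: the value is \<open>- b * s\<^sup>2\<close> or
  \<open>- a * s\<^sup>2\<close> at the left end and non-negative at \<open>s + a + b\<close>. For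
  \<open>s > 0\<close> the root exceeds \<open>a\<close> and \<open>b\<close>, as positivity of the
  weights requires.\<close>

lemma join_cubic_large_root:
  assumes "s \<ge> 0" "a \<ge> 0" "b \<ge> 0"
  shows "\<exists>y. max a b + s \<le> y \<and> join_cubic s a b y = 0"
proof -
  have "join_cubic s a b (a + s) = - b * s\<^sup>2" "join_cubic s a b (b + s) = - a * s\<^sup>2"
    by (simp_all add: join_cubic_def algebra_simps power2_eq_square power3_eq_cube)
  then have "join_cubic s a b (max a b + s) \<le> 0"
    using assms by (auto simp: max_def)
  moreover have "join_cubic s a b (s + a + b) = a * b * (s + a + b + s)"
    by (simp add: join_cubic_def power2_eq_square power3_eq_cube)
  then have "join_cubic s a b (s + a + b) \<ge> 0"
    using assms by simp
  moreover have "continuous_on {max a b + s..s + a + b} (join_cubic s a b)"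
    unfolding join_cubic_def[abs_def] by (intro continuous_intros)
  ultimately show ?thesis
    using IVT'[of "join_cubic s a b" "max a b + s" 0 "s + a + b"] assms by auto
qed

section \<open>Joins of a clique with two disjoint cliques\<close>

text \<open>Only vertex sets are fixed, no graph, so the same weights apply to \<open>H\<close> and
  to a graph \<open>G\<close> with a separator \<open>S\<close>.\<close>

locale vertex_separation =
  fixes S A B :: "'a set"
  assumes fin: "finite S" "finite A" "finite B"
    and disj: "S \<inter> A = {}" "S \<inter> B = {}" "A \<inter> B = {}"
begin

definition join_nbrs :: "'a \<Rightarrow> 'a set" where
  "join_nbrs u = (if u \<in> S then S \<union> A \<union> B else if u \<in> A then S \<union> A else S \<union> B) - {u}"

text \<open>
  For a root \<open>y\<close> of \<^const>\<open>join_cubic\<close> this is an eigenvector of the join of the clique on \<open>S\<close>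
  with the disjoint cliques on \<open>A\<close> and \<open>B\<close>, for the eigenvalue \<open>y - 1\<close>.
\<close>
definition weight :: "real \<Rightarrow> 'a \<Rightarrow> real" where
  "weight y u = (if u \<in> S then (y - real (card A)) * (y - real (card B))
     else if u \<in> A then real (card S) * (y - real (card B)) else real (card S) * (y - real (card A)))"

lemma sum_weight:
  "sum (weight y) S = real (card S) * ((y - real (card A)) * (y - real (card B)))"
  "sum (weight y) A = real (card A) * (real (card S) * (y - real (card B)))"
  "sum (weight y) B = real (card B) * (real (card S) * (y - real (card A)))"
proof -
  have "sum (weight y) S = (\<Sum>u\<in>S. (y - real (card A)) * (y - real (card B)))"
    by (intro sum.cong) (auto simp: weight_def)
  moreover have "sum (weight y) A = (\<Sum>u\<in>A. real (card S) * (y - real (card B)))"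
    using disj by (intro sum.cong) (auto simp: weight_def)
  moreover have "sum (weight y) B = (\<Sum>u\<in>B. real (card S) * (y - real (card A)))"
    using disj by (intro sum.cong) (auto simp: weight_def)
  ultimately show "sum (weight y) S = real (card S) * ((y - real (card A)) * (y - real (card B)))"
    "sum (weight y) A = real (card A) * (real (card S) * (y - real (card B)))"
    "sum (weight y) B = real (card B) * (real (card S) * (y - real (card A)))"
    by simp_all
qed

text \<open>Adding the weight of \<open>u\<close> itself completes the sum to whole parts. On
  \<open>A\<close> and \<open>B\<close> the eigenvalue equation then holds for every
  \<open>y\<close>; the cubic is the defect on \<open>S\<close>, and its sign decides whether the
  weights form a supersolution.\<close>

lemma sum_weight_join_nbrs:
  assumes "u \<in> S \<union> A \<union> B"
  shows "sum (weight y) (join_nbrs u) =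
    (y - 1) * weight y u - (if u \<in> S then join_cubic (real (card S)) (real (card A)) (real (card B)) y else 0)"
proof -
  have d: "(S \<union> A) \<inter> B = {}" using disj by blast
  consider "u \<in> S" | "u \<in> A" "u \<notin> S" | "u \<in> B" "u \<notin> S" "u \<notin> A" using assms by blast
  then show ?thesis
  proof cases
    case 1
    then have "sum (weight y) (join_nbrs u) = sum (weight y) (S \<union> A \<union> B) - weight y u"
      using fin by (simp add: join_nbrs_def sum_diff1)
    also have "sum (weight y) (S \<union> A \<union> B) = sum (weight y) S + sum (weight y) A + sum (weight y) B"
      using fin disj d by (simp add: sum.union_disjoint)
    finally show ?thesis
      using 1 by (simp add: sum_weight)
        (simp add: weight_def join_cubic_def algebra_simps power2_eq_square power3_eq_cube)
  next
    case 2
    then have "sum (weight y) (join_nbrs u) = sum (weight y) (S \<union> A) - weight y u"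
      using fin by (simp add: join_nbrs_def sum_diff1)
    also have "sum (weight y) (S \<union> A) = sum (weight y) S + sum (weight y) A"
      using fin disj by (simp add: sum.union_disjoint)
    finally show ?thesis
      using 2 by (simp add: sum_weight) (simp add: weight_def algebra_simps)
  next
    case 3
    then have "sum (weight y) (join_nbrs u) = sum (weight y) (S \<union> B) - weight y u"
      using fin by (simp add: join_nbrs_def sum_diff1)
    also have "sum (weight y) (S \<union> B) = sum (weight y) S + sum (weight y) B"
      using fin disj by (simp add: sum.union_disjoint)
    finally show ?thesis
      using 3 by (simp add: sum_weight) (simp add: weight_def algebra_simps)
  qed
qed

lemma weight_pos:
  assumes "S \<noteq> {}" "y > real (card A)" "y > real (card B)"
  shows "weight y u > 0"
  using assms fin by (auto simp: weight_def card_gt_0_iff)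

lemma finite_join_nbrs: "finite (join_nbrs u)"
  using fin by (simp add: join_nbrs_def)

text \<open>At a root \<open>y0\<close> beyond both clique sizes the weights are a positive
  eigenvector, hence also a test vector bounding all eigenvalues by \<open>y0 - 1\<close>. A root
  above \<open>y0\<close> would give a larger eigenvalue, so \<open>y0\<close> is the largest
  root.\<close>

lemma graph_spectral_radius_join:
  fixes H :: "'a pair_pre_digraph"
  assumes V: "pverts H = S \<union> A \<union> B" and sym: "sym (parcs H)"
    and nbrs: "\<And>u. u \<in> pverts H \<Longrightarrow> {v \<in> pverts H. (u, v) \<in> parcs H} = join_nbrs u"
    and S: "S \<noteq> {}"
  shows "join_cubic (real (card S)) (real (card A)) (real (card B)) (graph_spectral_radius H + 1) = 0"
    and "join_cubic (real (card S)) (real (card A)) (real (card B)) y = 0 \<Longrightarrow> y \<le> graph_spectral_radius H + 1"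
    and "max (real (card A)) (real (card B)) + real (card S) \<le> graph_spectral_radius H + 1"
proof -
  have finV: "finite (pverts H)" using fin V by simp
  have "S \<subseteq> pverts H" using V by blast
  have sPos: "real (card S) > 0" using S fin by (simp add: card_gt_0_iff)
  let ?q = "join_cubic (real (card S)) (real (card A)) (real (card B))"
  obtain y0 where y0: "max (real (card A)) (real (card B)) + real (card S) \<le> y0" "?q y0 = 0"
    using join_cubic_large_root[of "real (card S)" "real (card A)" "real (card B)"] by auto
  have gt: "y0 > real (card A)" "y0 > real (card B)" using y0(1) sPos by linarith+
  have ev: "eigenvalue (adjacency_matrix H) (y - 1)" if "?q y = 0" "y \<ge> y0" for y
  proof -
    have "weight y u > 0" for u using weight_pos[OF S] gt that(2) by simp
    then have "weight y u \<noteq> 0" for u by (metis less_irrefl)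
    moreover have "sum (weight y) {v \<in> pverts H. (u, v) \<in> parcs H} = (y - 1) * weight y u"
      if "u \<in> pverts H" for u
      using sum_weight_join_nbrs[of u y] that V nbrs[OF that] \<open>?q y = 0\<close> by simp
    ultimately show ?thesis
      unfolding eigenvalue_adjacency_matrix_iff[OF finV] using S \<open>S \<subseteq> pverts H\<close> by blast
  qed
  have le: "l \<le> y0 - 1" if "eigenvalue (adjacency_matrix H) l" for l
  proof (rule eigenvalue_le_of_test_vector[OF finV sym _ _ that])
    show "weight y0 u > 0" for u by (rule weight_pos[OF S gt])
    show "sum (weight y0) {v \<in> pverts H. (u, v) \<in> parcs H} \<le> (y0 - 1) * weight y0 u"
      if "u \<in> pverts H" for u
      using sum_weight_join_nbrs[of u y0] that V nbrs[OF that] y0(2) by simp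
  qed
  have eq: "graph_spectral_radius H = y0 - 1"
    using le[OF eigenvalue_graph_spectral_radius[OF finV _ sym]] S \<open>S \<subseteq> pverts H\<close>
      eigenvalue_le_graph_spectral_radius[OF ev[OF y0(2)]] by force
  show "?q (graph_spectral_radius H + 1) = 0"
    and "max (real (card A)) (real (card B)) + real (card S) \<le> graph_spectral_radius H + 1"
    using y0 eq by (simp_all add: of_nat_max)
  show "y \<le> graph_spectral_radius H + 1" if "?q y = 0"
    using le[OF ev[OF that]] eq by force
qed

text \<open>Missing edges and a non-negative cubic can only lower the neighbour sums, so the weights
  are a supersolution for \<open>y - 1\<close>. As \<open>l\<close> reaches this bound,
  connectedness forces equality everywhere, and positive weights leave no edge missing.\<close>

lemma eigenvalue_separated_graph:
  fixes G :: "'a pair_pre_digraph"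
  assumes V: "pverts G = S \<union> A \<union> B" and sym: "sym (parcs G)"
    and con: "Digraph_Component.connected (with_proj G)"
    and nbrs: "\<And>u. u \<in> pverts G \<Longrightarrow> {v \<in> pverts G. (u, v) \<in> parcs G} \<subseteq> join_nbrs u"
    and S: "S \<noteq> {}" and y: "y > real (card A)" "y > real (card B)"
    and q: "join_cubic (real (card S)) (real (card A)) (real (card B)) y \<ge> 0"
    and ev: "eigenvalue (adjacency_matrix G) l" and l: "y - 1 \<le> l"
  shows "join_cubic (real (card S)) (real (card A)) (real (card B)) y = 0"
    and "u \<in> pverts G \<Longrightarrow> {v \<in> pverts G. (u, v) \<in> parcs G} = join_nbrs u"
proof -
  let ?q = "join_cubic (real (card S)) (real (card A)) (real (card B)) y"
  let ?N = "\<lambda>u. {v \<in> pverts G. (u, v) \<in> parcs G}"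
  have finV: "finite (pverts G)" using fin V by simp
  note pos = weight_pos[OF S y]
  have le: "sum (weight y) (?N u) \<le> sum (weight y) (join_nbrs u)" if "u \<in> pverts G" for u
    using nbrs[OF that] pos by (intro sum_mono2 finite_join_nbrs) (auto simp: less_imp_le)
  have join: "sum (weight y) (join_nbrs u) = (y - 1) * weight y u - (if u \<in> S then ?q else 0)"
    if "u \<in> pverts G" for u
    using sum_weight_join_nbrs that V by blast
  have eq: "sum (weight y) (?N u) = (y - 1) * weight y u" if "u \<in> pverts G" for u
  proof (rule eigenvalue_eq_of_test_vector[OF finV sym pos _ ev con l that])
    show "sum (weight y) (?N u) \<le> (y - 1) * weight y u" if "u \<in> pverts G" for u
      using le[OF that] join[OF that] q by (auto split: if_splits)
  qed
  \<comment> \<open>The cubic enters the neighbour sum only at vertices of \<open>S\<close>.\<close>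
  obtain s where "s \<in> S" using S by blast
  then show "?q = 0"
    using le[of s] eq[of s] join[of s] q V by auto
  then have sum_eq: "sum (weight y) (?N u) = sum (weight y) (join_nbrs u)" if "u \<in> pverts G" for u
    using eq[OF that] join[OF that] by simp
  show "?N u = join_nbrs u" if u: "u \<in> pverts G"
  proof (rule ccontr)
    assume "?N u \<noteq> join_nbrs u"
    then obtain v where "v \<in> join_nbrs u - ?N u" using nbrs[OF u] by blast
    then have "sum (weight y) (?N u) < sum (weight y) (join_nbrs u)"
      using nbrs[OF u] pos by (intro sum_strict_mono2 finite_join_nbrs) (auto simp: less_imp_le)
    then show False using sum_eq[OF u] by simp
  qed
qed

end


section \<open>From low connectivity to a separation\<close>

lemma not_connected_induced_cut:
  assumes "\<not> Digraph_Component.connected (with_proj G \<restriction> X)" "X \<noteq> {}"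
  obtains A B where "A \<noteq> {}" "B \<noteq> {}" "A \<union> B = X" "A \<inter> B = {}"
    "\<And>u v. \<lbrakk>u \<in> A; v \<in> B\<rbrakk> \<Longrightarrow> (u, v) \<notin> parcs G \<and> (v, u) \<notin> parcs G"
proof -
  have arcs: "arcs_ends (with_proj G \<restriction> X) = {(u, v) \<in> parcs G. u \<in> X \<and> v \<in> X}"
    by (auto simp: arcs_ends_conv)
  obtain A where A: "A \<subseteq> X" "A \<noteq> {}" "A \<noteq> X"
    "\<forall>u \<in> A. \<forall>v \<in> X - A. (u, v) \<notin> parcs G \<and> (v, u) \<notin> parcs G"
    using assms unfolding connected_iff_no_cut arcs by auto
  then show thesis by (intro that[of A "X - A"]) auto
qed

lemma out_degree_with_proj:
  assumes "pair_wf_digraph G"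
  shows "out_degree (with_proj G) u = card {v \<in> pverts G. (u, v) \<in> parcs G}"
proof -
  interpret pair_wf_digraph G by fact
  have "out_arcs (with_proj G) u = Pair u ` {v \<in> pverts G. (u, v) \<in> parcs G}"
    by (auto simp: out_arcs_def dest: in_arcsD2)
  then show ?thesis
    by (simp add: out_degree_def card_image inj_on_def)
qed

lemma min_degree_le_card_nbrs:
  assumes "pair_graph G" "u \<in> pverts G"
  shows "min_degree G \<le> card {v \<in> pverts G. (u, v) \<in> parcs G}"
proof -
  interpret pair_graph G by fact
  show ?thesis
    unfolding min_degree_def out_degree_with_proj[OF pair_wf_digraph, symmetric]
    using assms(2) pair_finite_verts by (intro Min_le) auto
qed

lemma min_degree_less_card:
  assumes "pair_graph G" "pverts G \<noteq> {}"
  shows "min_degree G < card (pverts G)"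
proof -
  interpret pair_graph G by fact
  obtain u where u: "u \<in> pverts G" using assms(2) by blast
  have "min_degree G \<le> card {v \<in> pverts G. (u, v) \<in> parcs G}"
    by (rule min_degree_le_card_nbrs[OF assms(1) u])
  also have "\<dots> < card (pverts G)"
    using u pair_finite_verts by (intro psubset_card_mono) (auto dest: no_loops')
  finally show ?thesis .
qed

lemma min_separator:
  assumes G: "pair_graph G" and con: "Digraph_Component.connected (with_proj G)"
    and less: "vertex_connectivity G < min_degree G"
  obtains S A B where "pverts G = S \<union> A \<union> B" "S \<inter> A = {}" "S \<inter> B = {}" "A \<inter> B = {}"
    "A \<noteq> {}" "B \<noteq> {}" "card S = vertex_connectivity G"
    "\<And>u v. \<lbrakk>u \<in> A; v \<in> B\<rbrakk> \<Longrightarrow> (u, v) \<notin> parcs G \<and> (v, u) \<notin> parcs G"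
proof -
  interpret pair_graph G by fact
  let ?V = "pverts G"
  let ?cuts = "{S. S \<subset> ?V \<and> \<not> Digraph_Component.connected (with_proj G \<restriction> (?V - S))}"
  have fin: "finite ?cuts"
    by (rule finite_subset[of _ "Pow ?V"]) (use pair_finite_verts in auto)
  have ne: "?V \<noteq> {}" using con by (simp add: connected_iff_no_cut)
  \<comment> \<open>For a complete graph the connectivity would be \<open>card ?V - 1\<close>, which
    is at least the minimum degree.\<close>
  have not_complete: "\<not> complete_digraph (card ?V) (with_proj G)"
    using less min_degree_less_card[OF G ne] by (auto simp: vertex_connectivity_def)
  then have kappa: "vertex_connectivity G = Min (card ` ?cuts)"
    by (simp add: vertex_connectivity_def setcompr_eq_image)
  have "parcs G \<noteq> {(u, v). (u, v) \<in> ?V \<times> ?V \<and> u \<noteq> v}"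
    using not_complete pair_finite_verts by (auto simp: complete_digraph_pair_def)
  then obtain u v where uv: "u \<in> ?V" "v \<in> ?V" "u \<noteq> v" "(u, v) \<notin> parcs G"
    by (auto dest: in_arcsD1 in_arcsD2 no_loops')
  then have vu: "(v, u) \<notin> parcs G" using arcs_symmetric by blast
  \<comment> \<open>Deleting all but two non-adjacent vertices disconnects the graph, so the minimum
    is over a non-empty set and is attained.\<close>
  have "?V - (?V - {u, v}) = {u, v}" using uv by blast
  moreover have "\<not> Digraph_Component.connected (with_proj G \<restriction> {u, v})"
  proof
    assume "Digraph_Component.connected (with_proj G \<restriction> {u, v})"
    moreover have "arcs_ends (with_proj G \<restriction> {u, v}) = {}"
      using uv vu by (auto simp: arcs_ends_conv dest: no_loops')
    ultimately have "{u} = {u, v}"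
      unfolding connected_iff_no_cut by auto
    then show False using uv by blast
  qed
  ultimately have "?V - {u, v} \<in> ?cuts" using uv by auto
  then have "Min (card ` ?cuts) \<in> card ` ?cuts"
    using fin by (intro Min_in) auto
  then obtain S where "Min (card ` ?cuts) = card S" and "S \<in> ?cuts" by (rule imageE)
  then have S: "S \<in> ?cuts" "card S = vertex_connectivity G" using kappa by simp_all
  then have "?V - S \<noteq> {}" by blast
  with S obtain A B where "A \<noteq> {}" "B \<noteq> {}" "A \<union> B = ?V - S" "A \<inter> B = {}"
    "\<And>u v. \<lbrakk>u \<in> A; v \<in> B\<rbrakk> \<Longrightarrow> (u, v) \<notin> parcs G \<and> (v, u) \<notin> parcs G"
    using not_connected_induced_cut[of G "?V - S"] by blast
  then show thesis
    using S by (intro that[of S A B]) auto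
qed

text \<open>A vertex of \<open>A\<close> has all its neighbours in \<open>S \<union> A\<close>, and
  it is not its own neighbour.\<close>

lemma min_degree_less_separated_card:
  assumes G: "pair_graph G" and V: "pverts G = S \<union> A \<union> B" and A: "A \<noteq> {}"
    and sep: "\<And>u v. \<lbrakk>u \<in> A; v \<in> B\<rbrakk> \<Longrightarrow> (u, v) \<notin> parcs G"
  shows "min_degree G < card S + card A"
proof -
  interpret pair_graph G by fact
  have fin: "finite (S \<union> A)" using pair_finite_verts V by auto
  obtain u where u: "u \<in> A" using A by blast
  have "min_degree G \<le> card {v \<in> pverts G. (u, v) \<in> parcs G}"
    using u V by (intro min_degree_le_card_nbrs[OF G]) auto
  also have "\<dots> < card (S \<union> A)"
    using u V sep fin by (intro psubset_card_mono) (auto dest: no_loops')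
  also have "\<dots> \<le> card S + card A" by (rule card_Un_le)
  finally show ?thesis .
qed

text \<open>A minimum separator may have fewer than \<open>k - 1\<close> vertices. Moving vertices
  of \<open>A\<close> into it keeps it separating and gives the exact size; the degree bound
  controls what remains of \<open>A\<close>.\<close>

lemma separation_of_low_connectivity:
  assumes G: "pair_graph G" and con: "Digraph_Component.connected (with_proj G)"
    and less: "vertex_connectivity G < k" and k: "k \<le> min_degree G"
  obtains S A B where "pverts G = S \<union> A \<union> B" "S \<inter> A = {}" "S \<inter> B = {}" "A \<inter> B = {}"
    "card S = k - 1" "min_degree G - k + 2 \<le> card A" "min_degree G - k + 2 \<le> card B"
    "\<And>u v. \<lbrakk>u \<in> A; v \<in> B\<rbrakk> \<Longrightarrow> (u, v) \<notin> parcs G \<and> (v, u) \<notin> parcs G"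
proof -
  interpret pair_graph G by fact
  obtain S A B where V: "pverts G = S \<union> A \<union> B"
    and disj: "S \<inter> A = {}" "S \<inter> B = {}" "A \<inter> B = {}" and ne: "A \<noteq> {}" "B \<noteq> {}"
    and S: "card S = vertex_connectivity G"
    and sep: "\<And>u v. \<lbrakk>u \<in> A; v \<in> B\<rbrakk> \<Longrightarrow> (u, v) \<notin> parcs G \<and> (v, u) \<notin> parcs G"
    using min_separator[OF G con order.strict_trans2[OF less k]] by blast
  have fin: "finite S" "finite A" "finite B" using pair_finite_verts V by auto
  have cA: "min_degree G < card S + card A"
    using sep by (intro min_degree_less_separated_card[OF G V ne(1)]) auto
  have cB: "min_degree G < card S + card B"
    using sep V by (intro min_degree_less_separated_card[OF G _ ne(2), of S A]) auto
  \<comment> \<open>\<open>T\<close> is the part of \<open>A\<close> that pads the separator. As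
    \<open>card S + card A\<close> exceeds the minimum degree, \<open>A - T\<close> keeps at least
    \<open>min_degree G - k + 2\<close> vertices.\<close>
  have "k - 1 - card S \<le> card A" using cA k by simp
  then obtain T where T: "T \<subseteq> A" "card T = k - 1 - card S"
    by (metis obtain_subset_with_card_n)
  have finT: "finite T" using T fin finite_subset by blast
  have "card (S \<union> T) = k - 1"
    using T fin finT disj less S by (subst card_Un_disjoint) auto
  moreover have "card (A - T) = card A - card T"
    using T finT by (intro card_Diff_subset)
  ultimately show thesis
    using V disj sep cA cB T less S k by (intro that[of "S \<union> T" "A - T" B]) auto
qed

section \<open>The extremal graph and isomorphism to it\<close>

lemma digraph_iso_with_projI:
  assumes "pair_wf_digraph G" and "bij_betw f (pverts G) (pverts H)"
    and "parcs H = map_prod f f ` parcs G"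
  shows "digraph_iso (with_proj G) (with_proj H)"
proof -
  interpret pair_wf_digraph G by fact
  define h where "h = \<lparr>iso_verts = f, iso_arcs = map_prod f f, iso_head = snd, iso_tail = fst\<rparr>"
  have inj: "inj_on f (pverts G)" "f ` pverts G = pverts H"
    using assms(2) by (auto simp: bij_betw_def)
  have "inj_on (map_prod f f) (pverts G \<times> pverts G)"
    using inj by (intro map_prod_inj_on)
  then have "inj_on (map_prod f f) (parcs G)"
    by (rule inj_on_subset) (auto dest: in_arcsD1 in_arcsD2)
  then have "pre_digraph.digraph_isomorphism (with_proj G) h"
    using inj wf_digraph by (auto simp: pre_digraph.digraph_isomorphism_def h_def)
  moreover have "with_proj H = app_iso h (with_proj G)"
    using assms(3) inj by (simp add: app_iso_def h_def with_proj_def)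
  ultimately show ?thesis by (auto simp: digraph_iso_def)
qed

definition join_two_cliques :: "nat \<Rightarrow> nat \<Rightarrow> nat \<Rightarrow> (nat + nat + nat) pair_pre_digraph" where
  "join_two_cliques s a b =
     graph_join (complete_graph s) (disjoint_union (complete_graph a) (complete_graph b))"

lemma pverts_join_two_cliques:
  "pverts (join_two_cliques s a b) =
     Inl ` {..<s} \<union> Inr ` Inl ` {..<a} \<union> Inr ` Inr ` {..<b}"
  by (auto simp: join_two_cliques_def graph_join_def disjoint_union_def complete_graph_def Plus_def)

lemma map_prod_image: "map_prod f g ` R = {(f x, g y) |x y. (x, y) \<in> R}"
  by auto

lemma parcs_join_two_cliques:
  "(u, v) \<in> parcs (join_two_cliques s a b) \<longleftrightarrow>
     u \<in> pverts (join_two_cliques s a b) \<and> v \<in> pverts (join_two_cliques s a b) \<and> u \<noteq> v \<and>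
     (case (u, v) of (Inr (Inl _), Inr (Inr _)) \<Rightarrow> False
        | (Inr (Inr _), Inr (Inl _)) \<Rightarrow> False | _ \<Rightarrow> True)"
  by (cases u; cases v)
     (auto simp: join_two_cliques_def graph_join_def disjoint_union_def complete_graph_def Plus_def
       map_prod_image)

lemma sym_join_two_cliques: "sym (parcs (join_two_cliques s a b))"
  by (rule symI) (auto simp: parcs_join_two_cliques split: sum.splits)

lemma vertex_separation_join_two_cliques:
  fixes s a b :: nat
  shows
  "vertex_separation (Inl ` {..<s}) (Inr ` Inl ` {..<a}) (Inr ` Inr ` {..<b})"
  by unfold_locales auto

lemma nbrs_join_two_cliques:
  assumes "u \<in> pverts (join_two_cliques s a b)"
  shows "{v \<in> pverts (join_two_cliques s a b). (u, v) \<in> parcs (join_two_cliques s a b)} =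
    vertex_separation.join_nbrs (Inl ` {..<s}) (Inr ` Inl ` {..<a}) (Inr ` Inr ` {..<b}) u"
  using assms
  unfolding vertex_separation.join_nbrs_def[OF vertex_separation_join_two_cliques]
  by (auto simp: pverts_join_two_cliques parcs_join_two_cliques)

text \<open>The three tagged index ranges form a \<open>vertex_separation\<close> with part sizes
  \<open>s\<close>, \<open>a\<close>, \<open>b\<close>, so the result on joins transfers.\<close>

lemma graph_spectral_radius_join_two_cliques:
  fixes s a b :: nat
  assumes "s > 0"
  defines "r \<equiv> graph_spectral_radius (join_two_cliques s a b)"
  shows "join_cubic s a b (r + 1) = 0"
    and "join_cubic s a b y = 0 \<Longrightarrow> y \<le> r + 1"
    and "max (real a) (real b) + s \<le> r + 1"
proof -
  have ne: "Inl ` {..<s} \<noteq> ({} :: (nat + nat + nat) set)" using assms by auto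
  have card: "card (Inl ` {..<s} :: (nat + nat + nat) set) = s"
    "card (Inr ` Inl ` {..<a} :: (nat + nat + nat) set) = a"
    "card (Inr ` Inr ` {..<b} :: (nat + nat + nat) set) = b"
    by (simp_all add: card_image inj_on_def)
  note * = vertex_separation.graph_spectral_radius_join[OF vertex_separation_join_two_cliques[of s a b]
      pverts_join_two_cliques sym_join_two_cliques nbrs_join_two_cliques ne, unfolded card]
  show "join_cubic s a b (r + 1) = 0" unfolding r_def by (rule *(1))
  show "y \<le> r + 1" if "join_cubic s a b y = 0" unfolding r_def by (rule *(2)[OF _ that])
  show "max (real a) (real b) + s \<le> r + 1" unfolding r_def by (rule *(3))
qed

lemma (in vertex_separation) digraph_iso_join_two_cliques:
  fixes G :: "'a pair_pre_digraph"
  assumes G: "pair_wf_digraph G" and V: "pverts G = S \<union> A \<union> B"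
    and nbrs: "\<And>u. u \<in> pverts G \<Longrightarrow> {v \<in> pverts G. (u, v) \<in> parcs G} = join_nbrs u"
  shows "digraph_iso (with_proj G) (with_proj (join_two_cliques (card S) (card A) (card B)))"
proof -
  interpret pair_wf_digraph G by fact
  let ?H = "join_two_cliques (card S) (card A) (card B)"
  obtain f g h where f: "bij_betw f S {..<card S}" and g: "bij_betw g A {..<card A}"
    and h: "bij_betw h B {..<card B}"
    using fin by (metis ex_bij_betw_finite_nat lessThan_atLeast0)
  \<comment> \<open>Each part is numbered separately and tagged. Adjacency depends only on the parts
    and on distinctness, both of which \<open>\<phi>\<close> preserves.\<close>
  define \<phi> where "\<phi> u = (if u \<in> S then Inl (f u) else if u \<in> A then Inr (Inl (g u))
    else Inr (Inr (h u)) :: nat + nat + nat)" for u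
  have nA: "u \<notin> S" if "u \<in> A" for u using that disj by blast
  have nB: "u \<notin> S" "u \<notin> A" if "u \<in> B" for u using that disj by blast+
  have img: "f ` S = {..<card S}" "g ` A = {..<card A}" "h ` B = {..<card B}"
    and inj: "inj_on f S" "inj_on g A" "inj_on h B"
    using f g h by (auto simp: bij_betw_def)
  have "\<phi> ` S = Inl ` f ` S" "\<phi> ` A = Inr ` Inl ` g ` A" "\<phi> ` B = Inr ` Inr ` h ` B"
    using nA nB by (auto simp: \<phi>_def image_iff)
  then have surj: "\<phi> ` pverts G = pverts ?H"
    by (simp add: V pverts_join_two_cliques image_Un img)
  have inj_phi: "inj_on \<phi> (pverts G)"
    using inj nA nB by (auto simp: V inj_on_def \<phi>_def)
  have arcs: "(u, v) \<in> parcs G \<longleftrightarrow> (\<phi> u, \<phi> v) \<in> parcs ?H" if "u \<in> pverts G" "v \<in> pverts G" for u v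
  proof -
    have "(u, v) \<in> parcs G \<longleftrightarrow> v \<in> join_nbrs u" using nbrs[OF that(1)] that(2) by blast
    also have "\<dots> \<longleftrightarrow> (\<phi> u, \<phi> v) \<in> parcs ?H"
    proof -
      have "\<phi> u \<in> pverts ?H" "\<phi> v \<in> pverts ?H" "\<phi> u = \<phi> v \<longleftrightarrow> u = v"
        using surj inj_phi that by (auto simp: inj_on_eq_iff)
      then show ?thesis
        using that nA nB by (auto simp: parcs_join_two_cliques join_nbrs_def V \<phi>_def)
    qed
    finally show ?thesis .
  qed
  have "parcs ?H = map_prod \<phi> \<phi> ` parcs G"
  proof (rule subset_antisym; rule subsetI)
    fix e assume e: "e \<in> parcs ?H"
    obtain x y where xy: "e = (x, y)" by (cases e)
    with e have "x \<in> pverts ?H" "y \<in> pverts ?H" by (auto simp: parcs_join_two_cliques)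
    then obtain u v where uv: "u \<in> pverts G" "v \<in> pverts G" "x = \<phi> u" "y = \<phi> v"
      unfolding surj[symmetric] by blast
    then have "(u, v) \<in> parcs G" using arcs e xy by simp
    then show "e \<in> map_prod \<phi> \<phi> ` parcs G" using uv xy by force
  next
    fix e assume "e \<in> map_prod \<phi> \<phi> ` parcs G"
    then show "e \<in> parcs ?H" using arcs by (auto dest: in_arcsD1 in_arcsD2)
  qed
  then show ?thesis
    using surj inj_phi by (intro digraph_iso_with_projI[OF G, of \<phi>]) (auto simp: bij_betw_def)
qed

section \<open>Comparison of the two spectral radii\<close>

theorem theorem2p2:
  fixes G :: "'a pair_pre_digraph"
    and H :: "(nat + nat + nat) pair_pre_digraph"
    and n \<delta> k :: nat
    and p :: "real \<Rightarrow> real"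
  assumes "pair_graph G"
    and "Digraph_Component.connected (with_proj G)"
    and "n = card (pverts G)"
    and "\<delta> = min_degree G"
    and "\<delta> \<ge> k" and "k \<ge> 2"
    and "H = graph_join (complete_graph (k - 1))
               (disjoint_union (complete_graph (\<delta> - k + 2)) (complete_graph (n - \<delta> - 1)))"
    and "p = (\<lambda>x. x ^ 3 - (real n - 3) * x ^ 2
      + ((real \<delta> - real k + 2) * (real n - real \<delta> - 1) - 2 * real n + 3) * x
      + (real \<delta> - real k + 2) * (real n - real \<delta> - 1) * real k - real n + 1)"
  shows "(p (graph_spectral_radius H) = 0 \<and> (\<forall>x. p x = 0 \<longrightarrow> x \<le> graph_spectral_radius H))
    \<and> (graph_spectral_radius G \<ge> graph_spectral_radius H \<longrightarrow>
         vertex_connectivity G \<ge> k \<or> digraph_iso (with_proj G) (with_proj H))"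
proof -
  interpret pair_graph G by fact
  let ?N = "\<lambda>u. {v \<in> pverts G. (u, v) \<in> parcs G}"
  define s a b where "s = k - 1" and "a = \<delta> - k + 2" and "b = n - \<delta> - 1"
  have ne: "pverts G \<noteq> {}" using assms(2) by (simp add: connected_iff_no_cut)
  \<comment> \<open>This bound and \<open>k \<le> \<delta>\<close> keep the natural subtractions in
    \<open>a\<close> and \<open>b\<close> from truncating.\<close>
  have "\<delta> < n" using min_degree_less_card[OF assms(1) ne] assms(3,4) by simp
  then have real: "real s = real k - 1" "real a = real \<delta> - real k + 2" "real b = real n - real \<delta> - 1"
    using assms(5,6) by (auto simp: s_def a_def b_def)
  have sPos: "s > 0" using assms(6) by (simp add: s_def)
  have H: "H = join_two_cliques s a b"
    by (simp add: join_two_cliques_def assms(7) s_def a_def b_def)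
  \<comment> \<open>Here \<open>s + a + b = n\<close>.\<close>
  have p: "p x = join_cubic s a b (x + 1)" for x
    by (simp add: assms(8) join_cubic_def real algebra_simps power2_eq_square power3_eq_cube)
  define r where "r = graph_spectral_radius H"
  note rH = graph_spectral_radius_join_two_cliques[OF sPos, of a b, folded H r_def]
  have "p r = 0" "\<forall>x. p x = 0 \<longrightarrow> x \<le> r"
    using rH(1) rH(2)[of "_ + 1"] by (auto simp: p)
  moreover have "digraph_iso (with_proj G) (with_proj H)"
    if ge: "graph_spectral_radius G \<ge> r" and less: "vertex_connectivity G < k"
  proof -
    obtain S A B where V: "pverts G = S \<union> A \<union> B"
      and disj: "S \<inter> A = {}" "S \<inter> B = {}" "A \<inter> B = {}"
      and S: "card S = s" and cA: "a \<le> card A" and cB: "a \<le> card B"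
      and sep: "\<And>u v. \<lbrakk>u \<in> A; v \<in> B\<rbrakk> \<Longrightarrow> (u, v) \<notin> parcs G \<and> (v, u) \<notin> parcs G"
      using separation_of_low_connectivity[OF assms(1,2) less] assms(4,5)
      by (metis s_def a_def)
    interpret sep: vertex_separation S A B
      using pair_finite_verts disj V by unfold_locales auto
    interpret swap: vertex_separation S B A
      using pair_finite_verts disj V by unfold_locales auto
    have "n = card S + card A + card B"
      using sep.fin disj by (simp add: assms(3) V card_Un_disjoint Int_Un_distrib2)
    then have sum: "card A + card B = a + b"
      using assms(5,6) \<open>\<delta> < n\<close> S by (simp add: s_def a_def b_def)
    \<comment> \<open>The sum of the sizes is fixed, so the change of the product factors; both
      factors are non-negative by \<open>cA\<close> and \<open>cB\<close>.\<close>
    have "real (card A) * card B - real a * b = (real (card A) - a) * (real (card B) - a)"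
    proof -
      have b: "real b = real (card A) + card B - a" using sum by linarith
      show ?thesis unfolding b by (simp add: algebra_simps)
    qed
    then have diff: "join_cubic (card S) (card A) (card B) (r + 1) =
        (real (card A) - a) * (real (card B) - a) * (r + 1 + s)"
    proof -
      have "join_cubic (card S) (card A) (card B) (r + 1) - join_cubic s a b (r + 1) =
          (real (card A) * card B - real a * b) * (r + 1 + s)"
        using arg_cong[OF sum, of real] S by (simp add: join_cubic_def algebra_simps)
      then show ?thesis using rH(1) \<open>_ = (real (card A) - a) * _\<close> by simp
    qed
    have rpos: "r + 1 + s > 0" using rH(3) sPos by linarith
    have nbrs: "?N u \<subseteq> sep.join_nbrs u" if "u \<in> pverts G" for u
      using that sep by (auto simp: sep.join_nbrs_def V dest: no_loops')
    have "S \<noteq> {}" using S sPos by auto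
    \<comment> \<open>Each side has at least \<open>a\<close> vertices, hence at most
      \<open>b\<close>, and \<open>r + 1\<close> is at least \<open>max a b + s\<close>.\<close>
    have gt: "r + 1 > card A" "r + 1 > card B"
      using rH(3) sum cA cB sPos by linarith+
    have "join_cubic (card S) (card A) (card B) (r + 1) \<ge> 0"
      unfolding diff using cA cB rpos by simp
    note eq = sep.eigenvalue_separated_graph[OF V _ assms(2) nbrs \<open>S \<noteq> {}\<close> gt this
        eigenvalue_graph_spectral_radius[OF pair_finite_verts ne]]
    have symG: "sym (parcs G)" by (rule symI) (rule arcs_symmetric)
    have zero: "join_cubic (card S) (card A) (card B) (r + 1) = 0"
      and full: "\<And>u. u \<in> pverts G \<Longrightarrow> ?N u = sep.join_nbrs u"
      using eq[OF symG _ symG] ge by simp_all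
    \<comment> \<open>The factor \<open>r + 1 + s\<close> is positive, so one of the other two
      factors vanishes.\<close>
    then have "card A = a \<or> card B = a"
      using rpos by (simp add: diff)
    then show ?thesis
    proof
      assume A: "card A = a"
      with sum have "card B = b" by simp
      with A show ?thesis
        using sep.digraph_iso_join_two_cliques[OF pair_wf_digraph V full] S H by simp
    next
      assume B: "card B = a"
      with sum have A: "card A = b" by simp
      \<comment> \<open>\<open>H\<close> lists the clique of size \<open>a\<close> first, so the two
        sides exchange roles here.\<close>
      have V': "pverts G = S \<union> B \<union> A" using V by blast
      have "?N u = swap.join_nbrs u" if "u \<in> pverts G" for u
        unfolding full[OF that] using that disj
        by (auto simp: sep.join_nbrs_def swap.join_nbrs_def V)
      then show ?thesis
        using swap.digraph_iso_join_two_cliques[OF pair_wf_digraph V'] S H A B by simp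
    qed
  qed
  ultimately show ?thesis
    by (cases "vertex_connectivity G < k") (auto simp: r_def)
qed

end
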